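(* Let $a,b$ be integers with $0<a<b$ and suppose that $b$ is not a multiple of $a$. Let $[a_0,a_1,\dots,a_n]$ be the continued fraction expansion of $\frac{b}{a}$ (with $a_n>1$), and let $\mathcal{I}(a,b)$ be the largest nonnegative integer $i\le n$ such that $a_0=\dots=a_{i-1}\leq a_i$. Let $\mathcal{G}_E,\mathcal{G}_G,\mathcal{G}_M$ denote the Sprague-Grundy functions of Euclid, Grossman's game and M-Euclid respectively. Then: (1) $\mathcal{G}_M(a,b)=\mathcal{G}_E(a,b)$ except when $a_0=a_1=\dots=a_{n-1}\leq a_n$, in which case \[ \mathcal{G}_M(a,b)=\mathcal{G}_E(a,b)-(-1)^{\mathcal{I}(a,b)}. \] (2) $\mathcal{G}_M(a,b)=\mathcal{G}_G(a,b)$ except when $a_0=a_1=\dots=a_{n-1}<a_n$, in which case \[ \mathcal{G}_M(a,b)=\mathcal{G}_G(a,b)-(-1)^{\mathcal{I}(a,b)}. \]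
   Context: The three games are two-player impartial combinatorial games, played from a starting position that is an (unordered) pair of positive integers. The players move alternately; a move consists of subtracting a positive integer multiple of one of the entries from the other entry, without making the result negative. The player who makes the last move wins. The games differ in their terminal positions (positions with no moves available): - Euclid: the game stops when one of the entries is zero (so the player who reduces an entry to zero wins). - Grossman's game: the game is played on pairs of positive integers (entries remain positive) and stops when the two entries are equal. - M-Euclid: the game stops when one of the entries is a positive integer multiple of the other (in particular when the entries are equal). The Sprague-Grundy function $\mathcal{G}$ of each game is defined recursively: $\mathcal{G}(p)$ is the least nonnegative integer not in the set $\{\mathcal{G}(q): q \text{ is reachable from } p \text{ in one move}\}$; in particular it is $0$ at terminal positions. Continued fractions: $[a_0,a_1,\dots,a_n]=a_0+\cfrac{1}{a_1+\cfrac{1}{\ddots+\cfrac{1}{a_n}}}$ with positive integers $a_i$, and with the convention that $a_n>1$ if $n>0$, so that the expansion of a rational number $b/a>1$ is unique. Since $b$ is not a multiple of $a$, here $n\geq 1$. The condition $a_0=\dots=a_{i-1}\leq a_i$ is vacuously true for $i=0$, for $i=1$ it means $a_0\le a_1$, and for $i\geq 2$ it means $a_0=a_1=\dots=a_{i-1}$ and $a_{i-1}\leq a_i$. Likewise, when $n=1$ the condition $a_0=\dots=a_{n-1}\le a_n$ means $a_0\le a_1$, and $a_0=\dots=a_{n-1}<a_n$ means $a_0<a_1$. *)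

theory Defs
  imports Complex_Main "HOL-Library.Uprod"
begin

section \<open>Sprague-Grundy functions\<close>

definition mex :: "nat set \<Rightarrow> nat" where
  "mex A = (LEAST n. n \<notin> A)"

text \<open>The argument is the move relation of an impartial game: \<open>mv p q\<close> means that \<open>q\<close> is
  reachable from \<open>p\<close> in one move. The recursion is meaningful only for games in which no infinite
  play is possible; see \<open>grundy_rec\<close> below, and \<open>wf_euclid\<close>, \<open>wf_grossman\<close>, \<open>wf_meuclid\<close> for the
  three games considered here.\<close>

definition grundy :: "('p \<Rightarrow> 'p \<Rightarrow> bool) \<Rightarrow> 'p \<Rightarrow> nat" where
  "grundy mv = wfrec {(q, p). mv p q} (\<lambda>g p. mex {g q | q. mv p q})"

lemma grundy_rec:
  assumes "wf {(q, p). mv p q}"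
  shows "grundy mv p = mex {grundy mv q | q. mv p q}"
proof -
  let ?R = "{(q, p). mv p q}"
  have "grundy mv p = mex {cut (grundy mv) ?R p q | q. mv p q}"
    unfolding grundy_def by (subst wfrec[OF assms]) simp
  also have "{cut (grundy mv) ?R p q | q. mv p q} = {grundy mv q | q. mv p q}"
    by (auto simp: cut_def)
  finally show ?thesis .
qed


section \<open>Euclid, Grossman's game and M-Euclid\<close>

text \<open>Natural subtraction is exact here, as \<open>k * x \<le> y\<close>.\<close>

inductive subtract_multiple :: "nat uprod \<Rightarrow> nat uprod \<Rightarrow> bool" where
  "\<lbrakk>0 < x; 0 < k; k * x \<le> y\<rbrakk> \<Longrightarrow> subtract_multiple (Upair x y) (Upair x (y - k * x))"

definition euclid_move :: "nat uprod \<Rightarrow> nat uprod \<Rightarrow> bool" where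
  "euclid_move p q \<longleftrightarrow> 0 \<notin> set_uprod p \<and> subtract_multiple p q"

text \<open>In Grossman's game both entries have to remain positive.\<close>

definition grossman_move :: "nat uprod \<Rightarrow> nat uprod \<Rightarrow> bool" where
  "grossman_move p q \<longleftrightarrow> proper_uprod p \<and> subtract_multiple p q \<and> 0 \<notin> set_uprod q"

definition one_divides_other :: "nat uprod \<Rightarrow> bool" where
  "one_divides_other p \<longleftrightarrow> (\<exists>x k. 0 < k \<and> p = Upair x (k * x))"

definition meuclid_move :: "nat uprod \<Rightarrow> nat uprod \<Rightarrow> bool" where
  "meuclid_move p q \<longleftrightarrow> \<not> one_divides_other p \<and> subtract_multiple p q"

abbreviation grundy_E :: "nat \<Rightarrow> nat \<Rightarrow> nat" where
  "grundy_E a b \<equiv> grundy euclid_move (Upair a b)"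

abbreviation grundy_G :: "nat \<Rightarrow> nat \<Rightarrow> nat" where
  "grundy_G a b \<equiv> grundy grossman_move (Upair a b)"

abbreviation grundy_M :: "nat \<Rightarrow> nat \<Rightarrow> nat" where
  "grundy_M a b \<equiv> grundy meuclid_move (Upair a b)"

lemma wf_subtract_multiple: "wf {(q, p). subtract_multiple p q}"
proof (rule wfUNIVI)
  fix P :: "nat uprod \<Rightarrow> bool" and p
  assume IH: "\<forall>p. (\<forall>q. (q, p) \<in> {(q, p). subtract_multiple p q} \<longrightarrow> P q) \<longrightarrow> P p"
  have "P (Upair x y)" for x y
  proof (induction "x + y" arbitrary: x y rule: less_induct)
    case less
    have "P q" if "subtract_multiple (Upair x y) q" for q
      using that
    proof cases
      case (1 u k v)
      have "0 < k * u" using 1 by simp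
      then have "u + (v - k * u) < u + v" using 1 by linarith
      moreover have "u + v = x + y" using 1 by auto
      ultimately show ?thesis using less 1 by simp
    qed
    then show ?case using IH by simp
  qed
  then show "P p" by (cases p) simp
qed

lemma wf_euclid: "wf {(q, p). euclid_move p q}"
  by (rule wf_subset[OF wf_subtract_multiple]) (auto simp: euclid_move_def)

lemma wf_grossman: "wf {(q, p). grossman_move p q}"
  by (rule wf_subset[OF wf_subtract_multiple]) (auto simp: grossman_move_def)

lemma wf_meuclid: "wf {(q, p). meuclid_move p q}"
  by (rule wf_subset[OF wf_subtract_multiple]) (auto simp: meuclid_move_def)


section \<open>Continued fractions\<close>

text \<open>The list \<open>[a\<^sub>0, a\<^sub>1, \<dots>, a\<^sub>n]\<close> represents the continued fraction with these partial quotients;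
  the value of the empty list is irrelevant.\<close>

fun cf_value :: "nat list \<Rightarrow> rat" where
  "cf_value [] = 0"
| "cf_value [x] = of_nat x"
| "cf_value (x # y # ys) = of_nat x + 1 / cf_value (y # ys)"

definition is_cf_expansion :: "nat list \<Rightarrow> rat \<Rightarrow> bool" where
  "is_cf_expansion c r \<longleftrightarrow>
     c \<noteq> [] \<and> (\<forall>x\<in>set c. 0 < x) \<and> (1 < length c \<longrightarrow> 1 < last c) \<and> cf_value c = r"

lemma cf_expansion_exists:
  assumes "0 < a" "a < b"
  shows "\<exists>c. is_cf_expansion c (of_nat b / of_nat a) \<and> 1 < last c"
  using assms
proof (induction a arbitrary: b rule: less_induct)
  case (less a)
  show ?case
  proof (cases "a dvd b")
    case True
    then obtain k where k: "b = a * k" by blast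
    then have "1 < k" using less.prems by (cases "k = 0 \<or> k = 1") auto
    then have "is_cf_expansion [k] (of_nat b / of_nat a) \<and> 1 < last [k]"
      using k less.prems by (simp add: is_cf_expansion_def)
    then show ?thesis by blast
  next
    case False
    then have pos: "0 < b mod a" by (simp add: dvd_eq_mod_eq_0)
    have lt: "b mod a < a" using less.prems by simp
    from less.IH[OF lt pos lt] obtain c where
      c: "is_cf_expansion c (of_nat a / of_nat (b mod a))" "1 < last c" by blast
    then obtain x xs where xs: "c = x # xs" by (cases c) (auto simp: is_cf_expansion_def)
    have "of_nat b = (of_nat (b div a) * of_nat a + of_nat (b mod a) :: rat)"
      by (metis div_mult_mod_eq of_nat_add of_nat_mult)
    then have "of_nat b / of_nat a = (of_nat (b div a) + of_nat (b mod a) / of_nat a :: rat)"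
      using less.prems by (simp add: field_simps)
    moreover have "0 < b div a" using less.prems by (simp add: div_greater_zero_iff)
    ultimately have "is_cf_expansion (b div a # c) (of_nat b / of_nat a) \<and> 1 < last (b div a # c)"
      using c xs by (auto simp: is_cf_expansion_def)
    then show ?thesis by blast
  qed
qed

lemma cf_value_Cons: "c \<noteq> [] \<Longrightarrow> cf_value (x # c) = of_nat x + 1 / cf_value c"
  by (cases c) simp_all

lemma cf_value_pos: "c \<noteq> [] \<Longrightarrow> \<forall>x\<in>set c. 0 < x \<Longrightarrow> 0 < cf_value c"
  by (induction c rule: cf_value.induct) (auto intro!: add_nonneg_pos divide_pos_pos)

lemma cf_value_gt_1:
  assumes "c \<noteq> []" "\<forall>x\<in>set c. 0 < x" "1 < last c"
  shows "1 < cf_value c"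
proof (cases c rule: cf_value.cases)
  case (3 x y ys)
  have "0 < 1 / cf_value (y # ys)" using assms 3 by (intro divide_pos_pos cf_value_pos) auto
  moreover have "1 \<le> (of_nat x :: rat)" using assms 3 by simp
  ultimately have "1 < of_nat x + 1 / cf_value (y # ys)" by linarith
  then show ?thesis using 3 by simp
qed (use assms in auto)

lemma cf_value_floor:
  assumes "\<forall>x\<in>set (x # c). 0 < x" "c \<noteq> [] \<longrightarrow> 1 < last c"
  shows "\<lfloor>cf_value (x # c)\<rfloor> = int x"
proof (cases c)
  case (Cons y ys)
  then have "1 < cf_value c" using assms by (intro cf_value_gt_1) auto
  then show ?thesis using Cons by (intro floor_unique) (auto simp: field_simps)
qed simp

lemma cf_expansion_unique:
  assumes "is_cf_expansion c r" "is_cf_expansion d r"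
  shows "c = d"
proof -
  have "c = d" if "\<forall>x\<in>set c. 0 < x" "\<forall>x\<in>set d. 0 < x" "c \<noteq> []" "d \<noteq> []"
    "1 < length c \<longrightarrow> 1 < last c" "1 < length d \<longrightarrow> 1 < last d"
    "cf_value c = cf_value d" for c d
    using that
  proof (induction c arbitrary: d)
    case (Cons x c)
    obtain y e where d: "d = y # e" using Cons.prems(4) by (meson neq_Nil_conv)
    have c_last: "c \<noteq> [] \<longrightarrow> 1 < last c" using Cons.prems(5) by simp
    have e_last: "e \<noteq> [] \<longrightarrow> 1 < last e" using Cons.prems(6) d by simp
    have "\<lfloor>cf_value (x # c)\<rfloor> = int x" by (rule cf_value_floor) (fact Cons.prems c_last)+
    moreover have "\<lfloor>cf_value (y # e)\<rfloor> = int y"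
      by (rule cf_value_floor) (use Cons.prems(2) d e_last in simp_all)
    ultimately have xy: "x = y" using Cons.prems(7) d by simp
    have c_gt: "1 < cf_value c" if "c \<noteq> []"
      using that Cons.prems(1) c_last by (intro cf_value_gt_1) simp_all
    have e_gt: "1 < cf_value e" if "e \<noteq> []"
      using that Cons.prems(2) d e_last by (intro cf_value_gt_1) simp_all
    have eq: "cf_value (x # c) = cf_value (x # e)" using Cons.prems(7) d xy by simp
    show ?case
    proof (cases "c = []")
      case True
      have "e = []"
      proof (rule ccontr)
        assume "e \<noteq> []"
        then show False using eq True e_gt by (simp add: cf_value_Cons)
      qed
      then show ?thesis using True d xy by simp
    next
      case c: False
      have e: "e \<noteq> []"
      proof
        assume "e = []"
        then show False using eq c c_gt by (simp add: cf_value_Cons)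
      qed
      have "cf_value c = cf_value e" using eq c e by (simp add: cf_value_Cons)
      then have "c = e"
        by (intro Cons.IH) (use Cons.prems(1,2) d c e c_last e_last in simp_all)
      then show ?thesis using d xy by simp
    qed
  qed simp
  then show ?thesis using assms by (simp add: is_cf_expansion_def)
qed


section \<open>The index\<close>

text \<open>These are the conditions \<open>a\<^sub>0 = \<dots> = a\<^sub>i\<^sub>-\<^sub>1 \<le> a\<^sub>i\<close> and \<open>a\<^sub>0 = \<dots> = a\<^sub>i\<^sub>-\<^sub>1 < a\<^sub>i\<close>; for \<open>i = 0\<close> they
  hold vacuously.\<close>

definition const_then_le :: "nat list \<Rightarrow> nat \<Rightarrow> bool" where
  "const_then_le c i \<longleftrightarrow> (0 < i \<longrightarrow> (\<forall>j<i. c ! j = c ! 0) \<and> c ! (i - 1) \<le> c ! i)"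

definition const_then_less :: "nat list \<Rightarrow> nat \<Rightarrow> bool" where
  "const_then_less c i \<longleftrightarrow> (0 < i \<longrightarrow> (\<forall>j<i. c ! j = c ! 0) \<and> c ! (i - 1) < c ! i)"

text \<open>The last partial quotient has position \<open>length c - 1\<close>.\<close>

definition cf_index :: "nat list \<Rightarrow> nat" where
  "cf_index c = Max {i. i \<le> length c - 1 \<and> const_then_le c i}"

end

theory Submission
  imports Defs
begin

text \<open>
  Write \<open>b = q * a + r\<close> with \<open>0 < r < a\<close>. In each of the three games the moves from \<open>{a, b}\<close> lead
  exactly to the pairs \<open>{a, j * a + r}\<close> with \<open>j < q\<close>. Let \<open>m\<close> be the Grundy value of \<open>{r, a}\<close>, the
  pair with \<open>j = 0\<close>. The pairs with \<open>j = 1, \<dots>, m\<close> receive the values \<open>0, \<dots>, m - 1\<close>; beyond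
  them the value \<open>m\<close> is already taken by \<open>j = 0\<close>, and the pair with index \<open>j\<close> receives \<open>j\<close>.
  So the value of \<open>{a, b}\<close> is \<open>q - 1\<close> if \<open>q \<le> m\<close> and \<open>q\<close> otherwise, in all three games
  (\<open>grundy_step\<close>).

  Since \<open>q\<close> is the first partial quotient of \<open>b / a\<close> and the remaining ones belong to \<open>a / r\<close>, the
  Grundy value arises by folding this step over \<open>a\<^sub>0, \<dots>, a\<^sub>n\<^sub>-\<^sub>1\<close>, starting from the value of a pair
  \<open>{x, a\<^sub>n * x}\<close> (\<open>grundy_eq_foldr\<close>). The games differ only in this starting value, which is \<open>a\<^sub>n\<close>
  for Euclid, \<open>a\<^sub>n - 1\<close> for Grossman's game and \<open>0\<close> for M-Euclid.

  Thus both claims compare the fold started at some \<open>m\<close> with the fold started at \<open>0\<close>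
  (\<open>foldr_step_compare\<close>). The first step separates the two exactly when \<open>a\<^sub>n\<^sub>-\<^sub>1 \<le> m\<close>, and then the
  two values are \<open>y - 1\<close> and \<open>y\<close> for \<open>y = a\<^sub>n\<^sub>-\<^sub>1\<close>. A further step with quotient \<open>x\<close> merges the values
  \<open>y - 1\<close> and \<open>y\<close> unless \<open>x = y\<close>, in which case it interchanges them. So a difference survives only
  if \<open>a\<^sub>0 = \<dots> = a\<^sub>n\<^sub>-\<^sub>1 \<le> m\<close>, and its sign alternates with \<open>n\<close>. For \<open>m = a\<^sub>n\<close> and \<open>m = a\<^sub>n - 1\<close> these
  are the two exceptional cases.
\<close>

section \<open>Moves between pairs\<close>

text \<open>A multiple of the larger entry cannot be taken from the smaller one unless the two are equal,
  so every move keeps \<open>x\<close> and takes from the other entry.\<close>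

lemma subtract_multiple_iff:
  assumes "r < x" "0 < q"
  shows "subtract_multiple (Upair x (q * x + r)) p \<longleftrightarrow> (\<exists>j<q. p = Upair x (j * x + r))"
proof
  assume "subtract_multiple (Upair x (q * x + r)) p"
  then show "\<exists>j<q. p = Upair x (j * x + r)"
  proof cases
    case (1 u k v)
    have x_le: "x \<le> q * x + r" using assms by (cases q) auto
    have x_eq: "u = x \<and> v = q * x + r"
    proof (rule ccontr)
      assume "\<not> (u = x \<and> v = q * x + r)"
      then have uv: "u = q * x + r" "v = x" using 1 by auto
      have "u \<le> k * u" using 1 by simp
      then have "u = v" using 1 uv x_le by linarith
      then show False using uv \<open>\<not> (u = x \<and> v = q * x + r)\<close> by simp
    qed
    have "k \<le> q"
    proof (rule ccontr)
      assume "\<not> k \<le> q"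
      then have "(q + 1) * x \<le> k * x" by (intro mult_le_mono1) simp
      then show False using 1 x_eq assms by simp
    qed
    then have "q * x + r - k * x = (q - k) * x + r" by (simp add: diff_mult_distrib)
    then show ?thesis using 1 x_eq assms by (intro exI[of _ "q - k"]) auto
  qed
next
  assume "\<exists>j<q. p = Upair x (j * x + r)"
  then obtain j where j: "j < q" "p = Upair x (j * x + r)" by blast
  have le: "(q - j) * x \<le> q * x + r" by (simp add: diff_mult_distrib)
  have "q * x + r - (q - j) * x = j * x + r"
    using j mult_le_mono1[of j q x] by (simp add: diff_mult_distrib)
  then show "subtract_multiple (Upair x (q * x + r)) p"
    using subtract_multiple.intros[of x "q - j" "q * x + r"] le j assms by simp
qed

lemma not_one_divides_other:
  assumes "0 < r" "r < x" "0 < q"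
  shows "\<not> one_divides_other (Upair x (q * x + r))"
proof
  assume "one_divides_other (Upair x (q * x + r))"
  then obtain u k where "0 < k" and "Upair x (q * x + r) = Upair u (k * u)"
    unfolding one_divides_other_def by blast
  then consider "q * x + r = k * x" | "x = k * (q * x + r)" by auto
  then show False
  proof cases
    case 1
    then have "x dvd q * x + r" by simp
    then show False using assms by (simp add: dvd_add_right_iff nat_dvd_not_less)
  next
    case 2
    have "q * x + r \<le> k * (q * x + r)" "x \<le> q * x"
      using \<open>0 < k\<close> assms by simp_all
    then show False using 2 assms by linarith
  qed
qed


section \<open>The Grundy value as a fold over the partial quotients\<close>

lemma values_of_moves:
  assumes "\<And>p. mv s p \<longleftrightarrow> (\<exists>j\<in>J. p = f j)"
  shows "{g p | p. mv s p} = (\<lambda>j. g (f j)) ` J"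
  using assms by auto

lemma mex_eqI: "n \<notin> A \<Longrightarrow> {..<n} \<subseteq> A \<Longrightarrow> mex A = n"
  unfolding mex_def by (rule Least_equality) (auto simp: not_less[symmetric])

lemma mex_lessThan: "mex {..<n} = n"
  by (rule mex_eqI) auto

definition step :: "nat \<Rightarrow> nat \<Rightarrow> nat" where
  "step q m = (if q \<le> m then q - 1 else q)"

text \<open>The values \<open>step j m\<close> for \<open>j = 1, 2, \<dots>\<close> are \<open>0, \<dots>, m - 1, m + 1, m + 2, \<dots>\<close>: they enumerate
  the numbers other than \<open>m\<close> in increasing order. Together with \<open>m\<close>, the first \<open>q - 1\<close> of them therefore
  leave the next one, \<open>step q m\<close>, as the least missing number.\<close>

lemma mex_step: "0 < q \<Longrightarrow> mex (insert m ((\<lambda>j. step j m) ` {0<..<q})) = step q m"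
proof (rule mex_eqI)
  assume "0 < q"
  then show "step q m \<notin> insert m ((\<lambda>j. step j m) ` {0<..<q})"
    by (auto simp: step_def split: if_splits)
next
  show "{..<step q m} \<subseteq> insert m ((\<lambda>j. step j m) ` {0<..<q})"
  proof
    fix i assume i: "i \<in> {..<step q m}"
    consider "i < m" | "i = m" | "m < i" by linarith
    then show "i \<in> insert m ((\<lambda>j. step j m) ` {0<..<q})"
    proof cases
      case 1
      have "Suc i < q" using i 1 by (auto simp: step_def split: if_splits)
      moreover have "step (Suc i) m = i" using 1 by (simp add: step_def)
      ultimately show ?thesis by (intro insertI2 image_eqI[of _ _ "Suc i"]) auto
    next
      case 3
      then have "step i m = i" "i < q" using i by (auto simp: step_def split: if_splits)
      then show ?thesis using 3 by (intro insertI2 image_eqI[of _ _ i]) auto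
    qed simp
  qed
qed

text \<open>What the three games share: the same moves as long as neither entry is a multiple of the
  other. The rules for a pair \<open>{x, k * x}\<close> enter only through its Grundy value.\<close>

locale euclidean_game =
  fixes mv :: "nat uprod \<Rightarrow> nat uprod \<Rightarrow> bool" and base :: "nat \<Rightarrow> nat"
  assumes wf: "wf {(q, p). mv p q}"
    and moves: "\<And>x q r p. 0 < r \<Longrightarrow> r < x \<Longrightarrow> 0 < q \<Longrightarrow>
      mv (Upair x (q * x + r)) p \<longleftrightarrow> (\<exists>j<q. p = Upair x (j * x + r))"
    and base: "\<And>x k. 0 < x \<Longrightarrow> 0 < k \<Longrightarrow> grundy mv (Upair x (k * x)) = base k"
begin

lemma grundy_step:
  assumes "0 < r" "r < x" "0 < q"
  shows "grundy mv (Upair x (q * x + r)) = step q (grundy mv (Upair r x))"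
  using assms(3)
proof (induction q rule: less_induct)
  case (less q)
  let ?m = "grundy mv (Upair r x)"
  have swap: "Upair x r = Upair r x" by simp
  have "{grundy mv p | p. mv (Upair x (q * x + r)) p} = (\<lambda>j. grundy mv (Upair x (j * x + r))) ` {..<q}"
    by (rule values_of_moves) (use moves[OF assms(1,2) less.prems] in auto)
  also have "{..<q} = insert 0 {0<..<q}"
    using less.prems by auto
  also have "(\<lambda>j. grundy mv (Upair x (j * x + r))) ` \<dots> =
      insert ?m ((\<lambda>j. grundy mv (Upair x (j * x + r))) ` {0<..<q})"
    by (simp only: image_insert mult_0 add_0 swap)
  also have "(\<lambda>j. grundy mv (Upair x (j * x + r))) ` {0<..<q} = (\<lambda>j. step j ?m) ` {0<..<q}"
    using less.IH by (intro image_cong) auto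
  finally show ?case
    using grundy_rec[OF wf, of "Upair x (q * x + r)"] mex_step[OF less.prems] by simp
qed

end

lemma is_cf_expansion_single:
  assumes "is_cf_expansion [k] (of_nat b / of_nat a)" "0 < a"
  shows "b = k * a"
proof -
  have "(of_nat b :: rat) = of_nat (k * a)"
    using assms by (simp add: is_cf_expansion_def field_simps)
  then show ?thesis by (simp only: of_nat_eq_iff)
qed

text \<open>Dropping the first partial quotient is one division step of the Euclidean algorithm, because
  the remaining expansion has a value above \<open>1\<close>.\<close>

lemma is_cf_expansion_Cons:
  assumes exp: "is_cf_expansion (q # c) (of_nat b / of_nat a)" and "c \<noteq> []" "0 < a"
  obtains r where "0 < r" "r < a" "b = q * a + r" "is_cf_expansion c (of_nat a / of_nat r)"
proof
  have pos: "\<forall>x\<in>set (q # c). 0 < x" and last: "1 < last c"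
    and val: "cf_value (q # c) = of_nat b / of_nat a"
    using assms by (auto simp: is_cf_expansion_def)
  have "int (b div a) = int q"
    using cf_value_floor[OF pos] last val by (simp add: floor_divide_of_nat_eq)
  then have b: "b = q * a + b mod a" by (metis div_mult_mod_eq of_nat_eq_iff)
  then have "(of_nat b :: rat) = of_nat q * of_nat a + of_nat (b mod a)"
    by (metis of_nat_add of_nat_mult)
  moreover have "of_nat q + 1 / cf_value c = (of_nat b / of_nat a :: rat)"
    using val cf_value_Cons[OF \<open>c \<noteq> []\<close>] by simp
  ultimately have inv: "1 / cf_value c = of_nat (b mod a) / of_nat a"
    using \<open>0 < a\<close> by (simp add: field_simps)
  have cpos: "0 < cf_value c" using pos \<open>c \<noteq> []\<close> by (intro cf_value_pos) auto
  show "0 < b mod a"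
  proof (rule gr0I)
    assume "b mod a = 0"
    then show False using inv cpos by simp
  qed
  then have "cf_value c = of_nat a / of_nat (b mod a)"
    using inv cpos \<open>0 < a\<close> by (simp add: field_simps)
  then show "is_cf_expansion c (of_nat a / of_nat (b mod a))"
    using pos last \<open>c \<noteq> []\<close> by (auto simp: is_cf_expansion_def)
  show "b mod a < a" using \<open>0 < a\<close> by simp
  show "b = q * a + b mod a" by (fact b)
qed

lemma (in euclidean_game) grundy_eq_foldr:
  assumes "is_cf_expansion (xs @ [k]) (of_nat b / of_nat a)" "0 < a"
  shows "grundy mv (Upair a b) = foldr step xs (base k)"
  using assms
proof (induction xs arbitrary: a b)
  case Nil
  then have "b = k * a" "0 < k" using is_cf_expansion_single by (auto simp: is_cf_expansion_def)
  then show ?case using base Nil.prems by simp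
next
  case (Cons q xs)
  have exp: "is_cf_expansion (q # xs @ [k]) (of_nat b / of_nat a)" using Cons.prems by simp
  obtain r where "0 < r" "r < a" "b = q * a + r"
    "is_cf_expansion (xs @ [k]) (of_nat a / of_nat r)"
    by (rule is_cf_expansion_Cons[OF exp]) (use Cons.prems in simp_all)
  moreover have "0 < q" using Cons.prems by (simp add: is_cf_expansion_def)
  ultimately show ?case using grundy_step Cons.IH by simp
qed


section \<open>The three games\<close>

lemma zero_Upair_iff [simp]: "0 \<in> set_uprod (Upair x y) \<longleftrightarrow> x = 0 \<or> y = (0 :: nat)"
  by auto

lemma subtract_multiple_mult_iff:
  "0 < x \<Longrightarrow> 0 < k \<Longrightarrow> subtract_multiple (Upair x (k * x)) p \<longleftrightarrow> (\<exists>j<k. p = Upair x (j * x))"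
  using subtract_multiple_iff[of 0 x k p] by simp

interpretation E: euclidean_game euclid_move "\<lambda>k. k"
proof
  show "wf {(q, p). euclid_move p q}" by (rule wf_euclid)
  show "euclid_move (Upair x (q * x + r)) p \<longleftrightarrow> (\<exists>j<q. p = Upair x (j * x + r))"
    if "0 < r" "r < x" "0 < q" for x q r p
    using subtract_multiple_iff that by (auto simp: euclid_move_def)
  show "grundy euclid_move (Upair x (k * x)) = k" if "0 < x" for x k
  proof (induction k rule: less_induct)
    case (less k)
    have "{grundy euclid_move p | p. euclid_move (Upair x (k * x)) p} = {..<k}"
    proof (cases "k = 0")
      case False
      then have "euclid_move (Upair x (k * x)) p \<longleftrightarrow> (\<exists>j\<in>{..<k}. p = Upair x (j * x))" for p
        using subtract_multiple_mult_iff that by (auto simp: euclid_move_def)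
      then have "{grundy euclid_move p | p. euclid_move (Upair x (k * x)) p} =
          (\<lambda>j. grundy euclid_move (Upair x (j * x))) ` {..<k}"
        by (rule values_of_moves)
      then show ?thesis using less by simp
    qed (auto simp: euclid_move_def)
    then show ?case by (subst grundy_rec[OF wf_euclid]) (simp add: mex_lessThan)
  qed
qed

interpretation G: euclidean_game grossman_move "\<lambda>k. k - 1"
proof
  show "wf {(q, p). grossman_move p q}" by (rule wf_grossman)
  show "grossman_move (Upair x (q * x + r)) p \<longleftrightarrow> (\<exists>j<q. p = Upair x (j * x + r))"
    if "0 < r" "r < x" "0 < q" for x q r p
  proof -
    have "x < q * x + r" using that by (cases q) auto
    then show ?thesis using subtract_multiple_iff that by (auto simp: grossman_move_def)
  qed
  show "grundy grossman_move (Upair x (k * x)) = k - 1" if "0 < x" "0 < k" for x k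
    using that(2)
  proof (induction k rule: less_induct)
    case (less k)
    have "{grundy grossman_move p | p. grossman_move (Upair x (k * x)) p} = {..<k - 1}"
    proof (cases "k = 1")
      case False
      then have "grossman_move (Upair x (k * x)) p \<longleftrightarrow> (\<exists>j\<in>{1..<k}. p = Upair x (j * x))" for p
        using subtract_multiple_mult_iff \<open>0 < x\<close> less.prems by (fastforce simp: grossman_move_def)
      then have "{grundy grossman_move p | p. grossman_move (Upair x (k * x)) p} =
          (\<lambda>j. grundy grossman_move (Upair x (j * x))) ` {1..<k}"
        by (rule values_of_moves)
      also have "\<dots> = (\<lambda>j. j - 1) ` {1..<k}"
        using less.IH by (intro image_cong) auto
      also have "\<dots> = {..<k - 1}"
      proof
        show "{..<k - 1} \<subseteq> (\<lambda>j. j - 1) ` {1..<k}"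
        proof
          fix i assume "i \<in> {..<k - 1}"
          then show "i \<in> (\<lambda>j. j - 1) ` {1..<k}" by (intro image_eqI[of _ _ "Suc i"]) auto
        qed
      qed auto
      finally show ?thesis .
    qed (auto simp: grossman_move_def)
    then show ?case by (subst grundy_rec[OF wf_grossman]) (simp add: mex_lessThan)
  qed
qed

interpretation M: euclidean_game meuclid_move "\<lambda>_. 0"
proof
  show "wf {(q, p). meuclid_move p q}" by (rule wf_meuclid)
  show "meuclid_move (Upair x (q * x + r)) p \<longleftrightarrow> (\<exists>j<q. p = Upair x (j * x + r))"
    if "0 < r" "r < x" "0 < q" for x q r p
    using subtract_multiple_iff not_one_divides_other that by (simp add: meuclid_move_def)
  show "grundy meuclid_move (Upair x (k * x)) = 0" if "0 < x" "0 < k" for x k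
  proof -
    have "one_divides_other (Upair x (k * x))" using that by (auto simp: one_divides_other_def)
    then show ?thesis
      by (subst grundy_rec[OF wf_meuclid]) (simp add: meuclid_move_def mex_eqI)
  qed
qed


section \<open>Comparison of two folds\<close>

text \<open>In the exceptional case the two folds are \<open>y - 1\<close> and \<open>y\<close>, in an order given by the parity of
  the length, where \<open>y = hd xs\<close>. The induction rests on \<open>step x y\<close> and \<open>step x (y - 1)\<close> being
  different only for \<open>x = y\<close>, when they are \<open>y - 1\<close> and \<open>y\<close>.\<close>

lemma foldr_step_compare:
  assumes "xs \<noteq> []" "\<forall>x\<in>set xs. 0 < x"
  shows "if (\<forall>x\<in>set xs. x = hd xs) \<and> hd xs \<le> m
    then foldr step xs m = hd xs - of_bool (odd (length xs)) \<and>
      foldr step xs 0 = hd xs - of_bool (even (length xs))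
    else foldr step xs 0 = foldr step xs m"
  using assms
proof (induction xs rule: list_nonempty_induct)
  case (single x)
  then show ?case by (simp add: step_def)
next
  case (cons x xs)
  define y where "y = hd xs"
  define C where "C \<longleftrightarrow> (\<forall>z\<in>set xs. z = y) \<and> y \<le> m"
  have y: "y \<in> set xs" using cons.hyps by (simp add: y_def)
  then have "0 < y" using cons.prems by simp
  have IH: "if C
      then foldr step xs m = y - of_bool (odd (length xs)) \<and>
        foldr step xs 0 = y - of_bool (even (length xs))
      else foldr step xs 0 = foldr step xs m"
    using cons.IH cons.prems by (simp add: C_def y_def)
  have C_Cons: "(\<forall>z\<in>set (x # xs). z = hd (x # xs)) \<and> hd (x # xs) \<le> m \<longleftrightarrow> C \<and> x = y"
  proof (cases "x = y")
    case True
    then show ?thesis unfolding C_def list.sel list.set by blast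
  next
    case False
    then have "\<exists>z\<in>set xs. z \<noteq> x" using y by (intro bexI[of _ y]) simp_all
    then show ?thesis using False unfolding C_def list.sel list.set by blast
  qed
  consider "C" "x = y" | "C" "x < y" | "C" "y < x" | "\<not> C" by linarith
  then show ?case
    unfolding C_Cons by cases (use IH \<open>0 < y\<close> in \<open>auto simp: step_def\<close>)
qed

lemma foldr_step_difference:
  assumes "xs \<noteq> []" "\<forall>x\<in>set xs. 0 < x"
  shows "if (\<forall>x\<in>set xs. x = hd xs) \<and> hd xs \<le> m
    then int (foldr step xs 0) = int (foldr step xs m) - (-1) ^ length xs
    else foldr step xs 0 = foldr step xs m"
proof -
  have "0 < hd xs" using assms by simp
  then show ?thesis using foldr_step_compare[OF assms, of m] by (auto split: if_splits)
qed


section \<open>The index and the exceptional cases\<close>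

lemma const_prefix_iff:
  assumes "xs \<noteq> []"
  shows "(\<forall>j<length xs. (xs @ [k]) ! j = (xs @ [k]) ! 0) \<longleftrightarrow> (\<forall>x\<in>set xs. x = hd xs)"
proof -
  have "(xs @ [k]) ! 0 = hd xs" using assms by (simp add: nth_append hd_conv_nth)
  then show ?thesis unfolding all_set_conv_all_nth by (simp add: nth_append)
qed

lemma nth_last_const_prefix:
  assumes "xs \<noteq> []" "\<forall>x\<in>set xs. x = hd xs"
  shows "(xs @ [k]) ! (length xs - 1) = hd xs"
proof -
  have "(xs @ [k]) ! (length xs - 1) = last xs"
    using assms(1) by (simp add: nth_append last_conv_nth)
  also have "\<dots> = hd xs" using assms(2) last_in_set[OF assms(1)] by blast
  finally show ?thesis .
qed

lemma const_then_le_snoc: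
  assumes "xs \<noteq> []"
  shows "const_then_le (xs @ [k]) (length xs) \<longleftrightarrow> (\<forall>x\<in>set xs. x = hd xs) \<and> hd xs \<le> k"
proof -
  define P where "P \<longleftrightarrow> (\<forall>x\<in>set xs. x = hd xs)"
  have "P \<Longrightarrow> (xs @ [k]) ! (length xs - 1) = hd xs"
    unfolding P_def by (rule nth_last_const_prefix[OF assms])
  then show ?thesis
    unfolding const_then_le_def const_prefix_iff[OF assms] P_def[symmetric] using assms by auto
qed

lemma const_then_less_snoc:
  assumes "xs \<noteq> []"
  shows "const_then_less (xs @ [k]) (length xs) \<longleftrightarrow> (\<forall>x\<in>set xs. x = hd xs) \<and> hd xs < k"
proof -
  define P where "P \<longleftrightarrow> (\<forall>x\<in>set xs. x = hd xs)"
  have "P \<Longrightarrow> (xs @ [k]) ! (length xs - 1) = hd xs"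
    unfolding P_def by (rule nth_last_const_prefix[OF assms])
  then show ?thesis
    unfolding const_then_less_def const_prefix_iff[OF assms] P_def[symmetric] using assms by auto
qed

lemma const_then_less_imp_le: "const_then_less c i \<Longrightarrow> const_then_le c i"
  unfolding const_then_less_def const_then_le_def using less_imp_le by blast

lemma cf_index_eq_last: "const_then_le c (length c - 1) \<Longrightarrow> cf_index c = length c - 1"
  unfolding cf_index_def by (rule Max_eqI) auto

theorem mainTheorem2:
  fixes a b n :: nat and c :: "nat list"
  assumes "0 < a" and "a < b" and "\<not> a dvd b"
    and "is_cf_expansion c (of_nat b / of_nat a)"
    and "n = length c - 1"
  shows "(if const_then_le c n
          then int (grundy_M a b) = int (grundy_E a b) - (-1) ^ cf_index c
          else grundy_M a b = grundy_E a b) \<and>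
         (if const_then_less c n
          then int (grundy_M a b) = int (grundy_G a b) - (-1) ^ cf_index c
          else grundy_M a b = grundy_G a b)"
proof -
  obtain xs k where c: "c = xs @ [k]"
    using assms(4) by (metis is_cf_expansion_def rev_exhaust)
  have exp: "is_cf_expansion (xs @ [k]) (of_nat b / of_nat a)" using assms(4) c by simp
  have "xs \<noteq> []" using exp is_cf_expansion_single[of k b a] assms(1,3) by auto
  have pos: "\<forall>x\<in>set xs. 0 < x" and "0 < k" using exp by (auto simp: is_cf_expansion_def)
  have n: "n = length xs" using assms(5) c by simp
  have index: "cf_index c = n" if "const_then_le c n"
    using that cf_index_eq_last[of c] assms(5) by simp
  have le: "const_then_le c n \<longleftrightarrow> (\<forall>x\<in>set xs. x = hd xs) \<and> hd xs \<le> k"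
    using const_then_le_snoc[OF \<open>xs \<noteq> []\<close>] c n by simp
  have less: "const_then_less c n \<longleftrightarrow> (\<forall>x\<in>set xs. x = hd xs) \<and> hd xs \<le> k - 1"
    using const_then_less_snoc[OF \<open>xs \<noteq> []\<close>, of k] c n \<open>0 < k\<close> by auto
  note vals = E.grundy_eq_foldr[OF exp assms(1)] G.grundy_eq_foldr[OF exp assms(1)]
    M.grundy_eq_foldr[OF exp assms(1)]
  have E: "if const_then_le c n
      then int (grundy_M a b) = int (grundy_E a b) - (-1) ^ n else grundy_M a b = grundy_E a b"
    using foldr_step_difference[OF \<open>xs \<noteq> []\<close> pos, of k] unfolding vals le unfolding n .
  have G: "if const_then_less c n
      then int (grundy_M a b) = int (grundy_G a b) - (-1) ^ n else grundy_M a b = grundy_G a b"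
    using foldr_step_difference[OF \<open>xs \<noteq> []\<close> pos, of "k - 1"] unfolding vals less unfolding n .
  show ?thesis
  proof (rule conjI)
    show "if const_then_le c n
        then int (grundy_M a b) = int (grundy_E a b) - (-1) ^ cf_index c
        else grundy_M a b = grundy_E a b"
      using E index by (cases "const_then_le c n") simp_all
    show "if const_then_less c n
        then int (grundy_M a b) = int (grundy_G a b) - (-1) ^ cf_index c
        else grundy_M a b = grundy_G a b"
      using G index const_then_less_imp_le by (cases "const_then_less c n") simp_all
  qed
qed

end
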